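(* (i) The 6-sequent calculus $\mathbf{SF\text{-}Six}$ is sound and complete with respect to the matrix $\mathcal{M}_6$; that is, a finite set of signed formulas is provable in $\mathbf{SF\text{-}Six}$ if and only if it is valid in $\mathcal{M}_6$. (ii) The cut rule is admissible in $\mathbf{SF\text{-}Six}$.
   Context: Formulas are built from a denumerable set of propositional variables with the binary connectives $\wedge,\vee$ and the unary connectives $\neg,\nabla$. The matrix $\mathcal{M}_6$: the set of truth values is $\mathcal{T}_6=\{\mathbf 0,\frac13,\mathbf n,\mathbf b,\frac23,\mathbf 1\}$, ordered as the lattice $\mathbf 0<\frac13<\mathbf n<\frac23<\mathbf 1$ and $\frac13<\mathbf b<\frac23$, with $\mathbf n,\mathbf b$ incomparable. The designated values are $\mathcal{D}=\{\mathbf b,\frac23,\mathbf 1\}$. The connectives are interpreted by $x\hat\wedge y=\inf\{x,y\}$, $x\hat\vee y=\sup\{x,y\}$; $\hat\neg\mathbf 0=\mathbf 1$, $\hat\neg\frac13=\frac23$, $\hat\neg\mathbf n=\mathbf n$, $\hat\neg\mathbf b=\mathbf b$, $\hat\neg\frac23=\frac13$, $\hat\neg\mathbf 1=\mathbf 0$; $\hat\nabla\mathbf 0=\mathbf 0$ and $\hat\nabla x=\mathbf 1$ for $x\neq\mathbf 0$. A valuation is a map $v$ from formulas to $\mathcal{T}_6$ commuting with the connectives. A signed formula is an expression $t:\psi$ with $t\in\mathcal{T}_6$ and $\psi$ a formula; a valuation $v$ satisfies it iff $v(\psi)=t$. A finite set of signed formulas (equivalently, a 6-sequent) is satisfied by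 $v$ iff $v$ satisfies at least one of its members, and it is valid iff every valuation satisfies it. The calculus $\mathbf{SF\text{-}Six}$ derives finite sets of signed formulas; below $\Omega$ ranges over such sets and commas denote union. Axioms: $\{\mathbf 0:\alpha,\ \tfrac13:\alpha,\ \mathbf n:\alpha,\ \mathbf b:\alpha,\ \tfrac23:\alpha,\ \mathbf 1:\alpha\}$ for every formula $\alpha$. Structural rule (weakening): from $\Omega$ infer $\Omega'$ whenever $\Omega\subseteq\Omega'$. Logical rules, for all $i,j\in\mathcal{T}_6$: $(\vee_{i,j})$ from $\Omega,\ i:\alpha$ and $\Omega,\ j:\beta$ infer $\Omega,\ \sup\{i,j\}:\alpha\vee\beta$; $(\wedge_{i,j})$ from $\Omega,\ i:\alpha$ and $\Omega,\ j:\beta$ infer $\Omega,\ \inf\{i,j\}:\alpha\wedge\beta$; $(\neg_i)$ from $\Omega,\ i:\alpha$ infer $\Omega,\ \hat\neg i:\neg\alpha$; $(\nabla_i)$ from $\Omega,\ i:\alpha$ infer $\Omega,\ \hat\nabla i:\nabla\alpha$. The cut rule for sets of signed formulas: from $\Omega\cup\{i:\alpha\mid i\in I\}$ and $\Omega\cup\{j:\alpha\mid j\in J\}$ infer $\Omega\cup\{k:\alpha\mid k\in I\cap J\}$, for $I,J\subseteq\mathcal{T}_6$. A rule is admissible if whenever its premises are provable, so is its conclusion. *)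

theory Defs
  imports Main
begin

section \<open>The matrix of six truth values\<close>

text \<open>The values are 0, 1/3, n, b, 2/3, 1.\<close>

datatype tv = V0 | V13 | Vn | Vb | V23 | V1

text \<open>
  The order is that of the ranked poset in which \<open>Vn\<close> and \<open>Vb\<close> are the only two
  values sharing a level, hence the only incomparable ones. The lattice class instance
  certifies that the explicit \<open>inf\<close> and \<open>sup\<close> below are its greatest lower and
  least upper bounds.
\<close>

fun level :: "tv \<Rightarrow> nat" where
  "level V0 = 0"
| "level V13 = 1"
| "level Vn = 2"
| "level Vb = 2"
| "level V23 = 3"
| "level V1 = 4"

instantiation tv :: lattice
begin

definition less_eq_tv :: "tv \<Rightarrow> tv \<Rightarrow> bool" where
  "x \<le> y \<longleftrightarrow> x = y \<or> level x < level y"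

definition less_tv :: "tv \<Rightarrow> tv \<Rightarrow> bool" where
  "x < y \<longleftrightarrow> level x < level y"

definition inf_tv :: "tv \<Rightarrow> tv \<Rightarrow> tv" where
  "inf x y = (if x \<le> y then x else if y \<le> x then y else V13)"

definition sup_tv :: "tv \<Rightarrow> tv \<Rightarrow> tv" where
  "sup x y = (if x \<le> y then y else if y \<le> x then x else V23)"

instance
proof
  fix x y z :: tv
  show "(x < y) = (x \<le> y \<and> \<not> y \<le> x)"
    by (auto simp: less_eq_tv_def less_tv_def)
  show "x \<le> x"
    by (simp add: less_eq_tv_def)
  show "x \<le> y \<Longrightarrow> y \<le> z \<Longrightarrow> x \<le> z"
    by (auto simp: less_eq_tv_def)
  show "x \<le> y \<Longrightarrow> y \<le> x \<Longrightarrow> x = y"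
    by (auto simp: less_eq_tv_def)
  show "inf x y \<le> x" "inf x y \<le> y" "x \<le> sup x y" "y \<le> sup x y"
    by (cases x; cases y; simp add: less_eq_tv_def inf_tv_def sup_tv_def)+
  show "x \<le> y \<Longrightarrow> x \<le> z \<Longrightarrow> x \<le> inf y z"
    by (cases x; cases y; cases z; simp add: less_eq_tv_def inf_tv_def)
  show "y \<le> x \<Longrightarrow> z \<le> x \<Longrightarrow> sup y z \<le> x"
    by (cases x; cases y; cases z; simp add: less_eq_tv_def sup_tv_def)
qed

end

fun neg_tv :: "tv \<Rightarrow> tv" where
  "neg_tv V0 = V1"
| "neg_tv V13 = V23"
| "neg_tv Vn = Vn"
| "neg_tv Vb = Vb"
| "neg_tv V23 = V13"
| "neg_tv V1 = V0"

definition nabla_tv :: "tv \<Rightarrow> tv" where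
  "nabla_tv x = (if x = V0 then V0 else V1)"

text \<open>
  Part of the matrix, but satisfaction of signed formulas refers to exact values,
  so validity of sequents does not depend on it.
\<close>

definition designated :: "tv set" where
  "designated = {Vb, V23, V1}"


section \<open>Formulas, valuations and validity of sequents\<close>

datatype fm =
    Var nat
  | Conj fm fm
  | Disj fm fm
  | Neg fm
  | Nabla fm

definition valuation :: "(fm \<Rightarrow> tv) \<Rightarrow> bool" where
  "valuation v \<longleftrightarrow>
     (\<forall>\<alpha> \<beta>. v (Conj \<alpha> \<beta>) = inf (v \<alpha>) (v \<beta>)) \<and>
     (\<forall>\<alpha> \<beta>. v (Disj \<alpha> \<beta>) = sup (v \<alpha>) (v \<beta>)) \<and>
     (\<forall>\<alpha>. v (Neg \<alpha>) = neg_tv (v \<alpha>)) \<and>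
     (\<forall>\<alpha>. v (Nabla \<alpha>) = nabla_tv (v \<alpha>))"

text \<open>The pair \<open>(t, \<psi>)\<close> is the signed formula written \<open>t : \<psi>\<close> on paper.\<close>

type_synonym signed = "tv \<times> fm"

definition sat_signed :: "(fm \<Rightarrow> tv) \<Rightarrow> signed \<Rightarrow> bool" where
  "sat_signed v s \<longleftrightarrow> v (snd s) = fst s"

text \<open>Sequents are read disjunctively.\<close>

definition sat_sequent :: "(fm \<Rightarrow> tv) \<Rightarrow> signed set \<Rightarrow> bool" where
  "sat_sequent v \<Omega> \<longleftrightarrow> (\<exists>s\<in>\<Omega>. sat_signed v s)"

definition valid :: "signed set \<Rightarrow> bool" where
  "valid \<Omega> \<longleftrightarrow> (\<forall>v. valuation v \<longrightarrow> sat_sequent v \<Omega>)"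


section \<open>The calculus SF-Six\<close>

text \<open>
  The finiteness condition in weakening keeps every derivable set finite; the other
  rules preserve finiteness of their premises.
\<close>

inductive SF_Six :: "signed set \<Rightarrow> bool" where
  Axiom: "SF_Six {(V0, \<alpha>), (V13, \<alpha>), (Vn, \<alpha>), (Vb, \<alpha>), (V23, \<alpha>), (V1, \<alpha>)}"
| Weakening: "SF_Six \<Omega> \<Longrightarrow> \<Omega> \<subseteq> \<Omega>' \<Longrightarrow> finite \<Omega>' \<Longrightarrow> SF_Six \<Omega>'"
| Disj: "SF_Six (\<Omega> \<union> {(i, \<alpha>)}) \<Longrightarrow> SF_Six (\<Omega> \<union> {(j, \<beta>)}) \<Longrightarrow>
    SF_Six (\<Omega> \<union> {(sup i j, Disj \<alpha> \<beta>)})"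
| Conj: "SF_Six (\<Omega> \<union> {(i, \<alpha>)}) \<Longrightarrow> SF_Six (\<Omega> \<union> {(j, \<beta>)}) \<Longrightarrow>
    SF_Six (\<Omega> \<union> {(inf i j, Conj \<alpha> \<beta>)})"
| Neg: "SF_Six (\<Omega> \<union> {(i, \<alpha>)}) \<Longrightarrow> SF_Six (\<Omega> \<union> {(neg_tv i, Neg \<alpha>)})"
| Nabla: "SF_Six (\<Omega> \<union> {(i, \<alpha>)}) \<Longrightarrow> SF_Six (\<Omega> \<union> {(nabla_tv i, Nabla \<alpha>)})"

text \<open>A rule is the set of its instances, each a pair of premises and conclusion.\<close>

type_synonym seq_rule = "(signed set set \<times> signed set) set"

definition cut_rule :: seq_rule where
  "cut_rule =
     {({\<Omega> \<union> {(i, \<alpha>) | i. i \<in> I}, \<Omega> \<union> {(j, \<alpha>) | j. j \<in> J}},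
       \<Omega> \<union> {(k, \<alpha>) | k. k \<in> I \<inter> J}) | \<Omega> \<alpha> I J. finite \<Omega>}"

definition admissible :: "seq_rule \<Rightarrow> bool" where
  "admissible R \<longleftrightarrow>
     (\<forall>(premises, conclusion)\<in>R. (\<forall>\<Omega>\<in>premises. SF_Six \<Omega>) \<longrightarrow> SF_Six conclusion)"

end

theory Submission
  imports Defs
begin

text \<open>
  Soundness is an induction on derivations, and admissibility of cut then follows from
  soundness and completeness, because cut preserves validity.

  For completeness, let \<open>\<Omega>\<close> be a finite valid set that is not derivable. Among the
  underivable sets obtained from \<open>\<Omega>\<close> by adding signed variables of \<open>\<Omega>\<close>, choose a
  maximal one, \<open>\<Gamma>\<close>. By the axioms, each variable \<open>p\<close> of \<open>\<Omega>\<close> has a value \<open>s p\<close> whose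
  signed formula \<open>s p : p\<close> is missing from \<open>\<Gamma>\<close>; by maximality, \<open>\<Gamma>, s p : p\<close> is
  derivable. The logical rules mirror the truth tables, so these derivations compute the
  value of every formula \<open>\<phi>\<close> over those variables: \<open>\<Gamma>, v \<phi> : \<phi>\<close> is derivable, where \<open>v\<close> is
  the valuation determined by \<open>s\<close> (lemma \<open>SF_Six_eval\<close>). Since \<open>\<Omega>\<close> is valid, it contains
  such a signed formula \<open>v \<phi> : \<phi>\<close>, and hence \<open>\<Gamma>\<close> itself is derivable, a contradiction.
\<close>

lemma finite_UNIV_tv: "finite (UNIV :: tv set)"
proof (rule finite_subset)
  show "UNIV \<subseteq> {V0, V13, Vn, Vb, V23, V1}"
    using tv.exhaust by blast
qed simp

lemma SF_Six_finite: "SF_Six \<Omega> \<Longrightarrow> finite \<Omega>"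
  by (induction rule: SF_Six.induct) auto

lemma SF_Six_sound:
  assumes "SF_Six \<Omega>"
  shows "valid \<Omega>"
  unfolding valid_def
proof (intro allI impI)
  fix v
  assume v: "valuation v"
  show "sat_sequent v \<Omega>"
    using assms
  proof (induction rule: SF_Six.induct)
    case (Axiom \<alpha>)
    show ?case
      by (cases "v \<alpha>") (auto simp: sat_sequent_def sat_signed_def)
  next
    case (Weakening \<Omega> \<Omega>')
    then show ?case
      by (auto simp: sat_sequent_def)
  qed (use v in \<open>auto simp: sat_sequent_def sat_signed_def valuation_def\<close>)
qed

text \<open>The valuation determined by an assignment of truth values to the variables.\<close>

primrec eval :: "(nat \<Rightarrow> tv) \<Rightarrow> fm \<Rightarrow> tv" where
  "eval s (Var p) = s p"
| "eval s (Conj \<alpha> \<beta>) = inf (eval s \<alpha>) (eval s \<beta>)"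
| "eval s (Disj \<alpha> \<beta>) = sup (eval s \<alpha>) (eval s \<beta>)"
| "eval s (Neg \<alpha>) = neg_tv (eval s \<alpha>)"
| "eval s (Nabla \<alpha>) = nabla_tv (eval s \<alpha>)"

lemma valuation_eval: "valuation (eval s)"
  by (simp add: valuation_def)

text \<open>The propositional variables that occur in a formula.\<close>

primrec vars :: "fm \<Rightarrow> nat set" where
  "vars (Var p) = {p}"
| "vars (Conj \<alpha> \<beta>) = vars \<alpha> \<union> vars \<beta>"
| "vars (Disj \<alpha> \<beta>) = vars \<alpha> \<union> vars \<beta>"
| "vars (Neg \<alpha>) = vars \<alpha>"
| "vars (Nabla \<alpha>) = vars \<alpha>"

lemma finite_vars: "finite (vars \<phi>)"
  by (induction \<phi>) auto

lemma SF_Six_eval: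
  assumes "\<And>p. p \<in> vars \<phi> \<Longrightarrow> SF_Six (\<Gamma> \<union> {(s p, Var p)})"
  shows "SF_Six (\<Gamma> \<union> {(eval s \<phi>, \<phi>)})"
  using assms
proof (induction \<phi>)
  case (Conj \<alpha> \<beta>)
  then show ?case
    using SF_Six.Conj by simp
next
  case (Disj \<alpha> \<beta>)
  then show ?case
    using SF_Six.Disj by simp
next
  case (Neg \<alpha>)
  then show ?case
    using SF_Six.Neg by simp
next
  case (Nabla \<alpha>)
  then show ?case
    using SF_Six.Nabla by simp
qed simp

lemma SF_Six_all_values:
  assumes "finite \<Omega>" "\<And>t. (t, \<alpha>) \<in> \<Omega>"
  shows "SF_Six \<Omega>"
  using SF_Six.Weakening[OF SF_Six.Axiom[of \<alpha>]] assms by simp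

lemma SF_Six_complete:
  assumes fin: "finite \<Omega>" and valid: "valid \<Omega>"
  shows "SF_Six \<Omega>"
proof (rule ccontr)
  assume not_derivable: "\<not> SF_Six \<Omega>"
  define P where "P = (\<Union>(t, \<phi>)\<in>\<Omega>. vars \<phi>)"
  define U where "U = \<Omega> \<union> UNIV \<times> Var ` P"
  define K where "K = {\<Gamma>. \<Omega> \<subseteq> \<Gamma> \<and> \<Gamma> \<subseteq> U \<and> \<not> SF_Six \<Gamma>}"
  have "finite P"
    unfolding P_def using fin finite_vars by auto
  then have "finite U"
    unfolding U_def using fin finite_UNIV_tv by simp
  then have "finite K"
    unfolding K_def by simp
  moreover have "\<Omega> \<in> K"
    using not_derivable by (simp add: K_def U_def)
  ultimately obtain \<Gamma> where \<Gamma>: "\<Gamma> \<in> K" and max: "\<And>\<Delta>. \<Delta> \<in> K \<Longrightarrow> \<Gamma> \<subseteq> \<Delta> \<Longrightarrow> \<Gamma> = \<Delta>"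
    using finite_has_maximal[of K] by blast
  have sub: "\<Omega> \<subseteq> \<Gamma>" "\<Gamma> \<subseteq> U" and nd: "\<not> SF_Six \<Gamma>"
    using \<Gamma> by (auto simp: K_def)
  have "finite \<Gamma>"
    using sub \<open>finite U\<close> finite_subset by blast
  then have "\<forall>p. \<exists>t. (t, Var p) \<notin> \<Gamma>"
    using SF_Six_all_values nd by blast
  then obtain s where s: "\<And>p. (s p, Var p) \<notin> \<Gamma>"
    by metis
  have extend: "SF_Six (\<Gamma> \<union> {(s p, Var p)})" if "p \<in> P" for p
  proof (rule ccontr)
    assume "\<not> SF_Six (\<Gamma> \<union> {(s p, Var p)})"
    then have "\<Gamma> \<union> {(s p, Var p)} \<in> K"
      using sub that by (auto simp: K_def U_def)
    then have "\<Gamma> = \<Gamma> \<union> {(s p, Var p)}"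
      by (rule max) blast
    then show False
      using s[of p] by blast
  qed
  obtain \<phi> where \<phi>: "(eval s \<phi>, \<phi>) \<in> \<Omega>"
    using valid valuation_eval[of s]
    by (force simp: valid_def sat_sequent_def sat_signed_def)
  have "vars \<phi> \<subseteq> P"
    using \<phi> by (auto simp: P_def)
  then have "SF_Six (\<Gamma> \<union> {(eval s \<phi>, \<phi>)})"
    using extend by (intro SF_Six_eval) blast
  moreover have "\<Gamma> \<union> {(eval s \<phi>, \<phi>)} = \<Gamma>"
    using \<phi> sub by blast
  ultimately show False
    using nd by simp
qed

lemma valid_cut:
  assumes "valid (\<Omega> \<union> {(i, \<alpha>) | i. i \<in> I})" "valid (\<Omega> \<union> {(j, \<alpha>) | j. j \<in> J})"
  shows "valid (\<Omega> \<union> {(k, \<alpha>) | k. k \<in> I \<inter> J})"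
  using assms by (fastforce simp: valid_def sat_sequent_def sat_signed_def)

lemma admissible_cut: "admissible cut_rule"
proof -
  have "SF_Six (\<Omega> \<union> {(k, \<alpha>) | k. k \<in> I \<inter> J})"
    if prems: "SF_Six (\<Omega> \<union> {(i, \<alpha>) | i. i \<in> I})"
      "SF_Six (\<Omega> \<union> {(j, \<alpha>) | j. j \<in> J})" for \<Omega> \<alpha> I J
  proof (rule SF_Six_complete)
    show "finite (\<Omega> \<union> {(k, \<alpha>) | k. k \<in> I \<inter> J})"
      by (rule finite_subset[OF _ SF_Six_finite[OF prems(1)]]) blast
    show "valid (\<Omega> \<union> {(k, \<alpha>) | k. k \<in> I \<inter> J})"
      using prems by (intro valid_cut SF_Six_sound)
  qed
  then show ?thesis
    unfolding admissible_def cut_rule_def by blast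
qed

theorem proposition4p1:
  shows "(\<forall>\<Omega> :: signed set. finite \<Omega> \<longrightarrow> (SF_Six \<Omega> \<longleftrightarrow> valid \<Omega>))
       \<and> admissible cut_rule"
  using SF_Six_sound SF_Six_complete admissible_cut by blast

end
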